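(* Let $m_1,\ldots,m_k$ be positive integers with sum $M$. The set of exact $k$-typed parking functions of order $(m_1,\ldots,m_k)$ results in exactly $$L=\prod_{i=1}^{k}\binom{m_1+\cdots+m_i}{m_i}$$ distinct parking configurations.
   Context: There are $M$ cars, $m_i$ of them of type $i$, and $M$ parking spots in a row. Consider tuples $\alpha=(m_1;P_2,\ldots,P_k)$, where each $P_i=(p^{(i)}_1,\ldots,p^{(i)}_{m_i})$ is an ordered list of nonnegative integers (for $k=1$, $\alpha=(m_1)$). Such an $\alpha$ is an exact $k$-typed parking function (exact $k$-TPF) of order $(m_1,\ldots,m_k)$ if there is an arrangement of the $M$ cars in the $M$ spots, one car per spot, such that for all $2\le i\le k$ and $1\le j\le m_i$ the $j$-th car of type $i$ has exactly $p^{(i)}_j$ cars of types in $\{1,\ldots,i-1\}$ parked before it. A parking configuration is a word $C$ of length $M$ in the letters $1,\ldots,k$ in which each letter $i$ occurs exactly $m_i$ times (cars of the same type are not distinguished); $\alpha$ results in $C$ if $C$ is the word of types of the cars, read from spot $1$ to spot $M$, in such an arrangement. *)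

theory Defs
  imports Main
begin

text \<open>
  The number of types is \<^term>\<open>k :: nat\<close>, and \<^term>\<open>m i :: nat\<close> is the number of cars of
  type \<open>i\<close> for \<open>1 \<le> i \<le> k\<close>; values of \<open>m\<close> outside this range play no role.
  Types, cars of a type and parking spots are all numbered from 1.
\<close>

definition num_cars :: "nat \<Rightarrow> (nat \<Rightarrow> nat) \<Rightarrow> nat" where
  "num_cars k m = (\<Sum>i=1..k. m i)"

text \<open>The pair \<open>(i, j)\<close> stands for the \<open>j\<close>-th car of type \<open>i\<close>.\<close>

definition cars :: "nat \<Rightarrow> (nat \<Rightarrow> nat) \<Rightarrow> (nat \<times> nat) set" where
  "cars k m = (SIGMA i:{1..k}. {1..m i})"

text \<open>An arrangement sends each car to the spot it is parked in.\<close>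

definition arrangement :: "nat \<Rightarrow> (nat \<Rightarrow> nat) \<Rightarrow> (nat \<times> nat \<Rightarrow> nat) \<Rightarrow> bool" where
  "arrangement k m park \<longleftrightarrow> bij_betw park (cars k m) {1..num_cars k m}"

text \<open>
  A tuple \<open>(m\<^sub>1; P\<^sub>2, \<dots>, P\<^sub>k)\<close> is encoded as the pair of \<open>m\<^sub>1\<close> and the list
  \<open>[P\<^sub>2, \<dots>, P\<^sub>k]\<close>, which is empty for \<open>k = 1\<close>.  List positions start at 0, so \<open>P\<^sub>i\<close> sits
  at position \<open>i - 2\<close>.
\<close>

type_synonym typed_tuple = "nat \<times> nat list list"

definition pref :: "typed_tuple \<Rightarrow> nat \<Rightarrow> nat list" where
  "pref \<alpha> i = snd \<alpha> ! (i - 2)"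

definition has_order :: "nat \<Rightarrow> (nat \<Rightarrow> nat) \<Rightarrow> typed_tuple \<Rightarrow> bool" where
  "has_order k m \<alpha> \<longleftrightarrow>
     fst \<alpha> = m 1 \<and> length (snd \<alpha>) = k - 1 \<and> (\<forall>i\<in>{2..k}. length (pref \<alpha> i) = m i)"

definition realizes ::
  "nat \<Rightarrow> (nat \<Rightarrow> nat) \<Rightarrow> typed_tuple \<Rightarrow> (nat \<times> nat \<Rightarrow> nat) \<Rightarrow> bool" where
  "realizes k m \<alpha> park \<longleftrightarrow>
     (\<forall>i\<in>{2..k}. \<forall>j\<in>{1..m i}.
        card {c \<in> cars k m. fst c \<in> {1..i - 1} \<and> park c < park (i, j)} = pref \<alpha> i ! (j - 1))"

definition exact_TPF :: "nat \<Rightarrow> (nat \<Rightarrow> nat) \<Rightarrow> typed_tuple \<Rightarrow> bool" where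
  "exact_TPF k m \<alpha> \<longleftrightarrow>
     has_order k m \<alpha> \<and> (\<exists>park. arrangement k m park \<and> realizes k m \<alpha> park)"

definition parking_configuration :: "nat \<Rightarrow> (nat \<Rightarrow> nat) \<Rightarrow> nat list \<Rightarrow> bool" where
  "parking_configuration k m C \<longleftrightarrow>
     length C = num_cars k m \<and> set C \<subseteq> {1..k} \<and> (\<forall>i\<in>{1..k}. count_list C i = m i)"

text \<open>The letter of \<open>C\<close> for spot \<open>s\<close>, at list position \<open>s - 1\<close>, is the type of the car there.\<close>

definition word_of_types ::
  "nat \<Rightarrow> (nat \<Rightarrow> nat) \<Rightarrow> (nat \<times> nat \<Rightarrow> nat) \<Rightarrow> nat list \<Rightarrow> bool" where
  "word_of_types k m park C \<longleftrightarrow>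
     length C = num_cars k m \<and> (\<forall>(i, j)\<in>cars k m. C ! (park (i, j) - 1) = i)"

definition results_in :: "nat \<Rightarrow> (nat \<Rightarrow> nat) \<Rightarrow> typed_tuple \<Rightarrow> nat list \<Rightarrow> bool" where
  "results_in k m \<alpha> C \<longleftrightarrow>
     (\<exists>park. arrangement k m park \<and> realizes k m \<alpha> park \<and> word_of_types k m park C)"

end

theory Submission
  imports Defs "HOL-Combinatorics.Multiset_Permutations"
begin

text \<open>
  Realizability places no restriction on a configuration: for any word with the right number of
  letters, park the cars of type \<open>i\<close> bijectively in the spots that carry the letter \<open>i\<close>, and
  record for each car how many cars of smaller types precede it.  The recorded numbers form an
  exact typed parking function that results in the given word
  (\<open>parking_configuration_is_result\<close>).

  So the words to count are the permutations of a multiset, and their number is a multinomial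
  coefficient.  It factors into the binomial coefficients of the statement because the cars can
  be inserted type by type: in the row formed by the \<open>m 1 + \<dots> + m i\<close> cars of types up to \<open>i\<close>,
  those of type \<open>i\<close> take an arbitrary set of \<open>m i\<close> places
  (\<open>prod_binomial_times_prod_fact\<close>).
\<close>

text \<open>Type \<open>i\<close> occupies exactly the spots of the letter \<open>i\<close>, so the cars of each type can be
  parked separately, in any order.\<close>

lemma parking_configuration_has_arrangement:
  assumes "parking_configuration k m C"
  obtains park where "arrangement k m park" "word_of_types k m park C"
proof -
  define M where "M = num_cars k m"
  define spots where "spots i = {s \<in> {1..M}. C ! (s - 1) = i}" for i
  have len: "length C = M" and letters: "set C \<subseteq> {1..k}"
    and occ: "\<And>i. i \<in> {1..k} \<Longrightarrow> count_list C i = m i"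
    using assms by (auto simp: parking_configuration_def M_def)
  have "\<exists>h. bij_betw h {1..m i} (spots i)" if "i \<in> {1..k}" for i
  proof -
    have "spots i = Suc ` {s. s < length C \<and> C ! s = i}"
    proof (intro set_eqI iffI)
      fix s assume "s \<in> spots i"
      then show "s \<in> Suc ` {s. s < length C \<and> C ! s = i}"
        by (cases s) (auto simp: spots_def len)
    qed (auto simp: spots_def len)
    then have "card (spots i) = card {s. s < length C \<and> C ! s = i}"
      by (simp add: card_image)
    also have "\<dots> = count_list C i"
      by (simp add: count_list_eq_length_filter length_filter_conv_card eq_commute)
    finally have "card (spots i) = m i"
      using occ[OF that] by simp
    moreover have "finite (spots i)"
      by (simp add: spots_def)
    ultimately show ?thesis
      using ex_bij_betw_nat_finite_1 by metis
  qed
  then obtain h where h: "\<And>i. i \<in> {1..k} \<Longrightarrow> bij_betw (h i) {1..m i} (spots i)"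
    by metis
  define park where "park = (\<lambda>(i, j). h i j)"
  have in_spots: "park (i, j) \<in> spots i" if "(i, j) \<in> cars k m" for i j
    using h[of i] that by (auto simp: park_def cars_def bij_betw_def)
  have "inj_on park (cars k m)"
  proof (intro inj_onI, clarify)
    fix i j i' j'
    assume car: "(i, j) \<in> cars k m" and car': "(i', j') \<in> cars k m"
      and same: "park (i, j) = park (i', j')"
    from in_spots[OF car] in_spots[OF car'] same have "i = i'"
      by (simp add: spots_def)
    moreover from this have "j = j'"
      using h[of i] car car' same by (auto simp: park_def cars_def bij_betw_def dest: inj_onD)
    ultimately show "i = i' \<and> j = j'" by simp
  qed
  moreover have "park ` cars k m = {1..M}"
  proof
    show "park ` cars k m \<subseteq> {1..M}"
      using in_spots by (auto simp: spots_def)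
    show "{1..M} \<subseteq> park ` cars k m"
    proof
      fix s assume s: "s \<in> {1..M}"
      define i where "i = C ! (s - 1)"
      have "i \<in> set C"
        unfolding i_def using s len by (intro nth_mem) auto
      with letters have i: "i \<in> {1..k}" by blast
      have "s \<in> spots i"
        using s by (simp add: spots_def i_def)
      then obtain j where "j \<in> {1..m i}" "h i j = s"
        using h[OF i] by (metis bij_betw_imp_surj_on imageE)
      then show "s \<in> park ` cars k m"
        using i by (intro image_eqI[of _ _ "(i, j)"]) (auto simp: park_def cars_def)
    qed
  qed
  ultimately have "arrangement k m park"
    by (simp add: arrangement_def bij_betw_def M_def)
  moreover have "word_of_types k m park C"
    using in_spots len by (auto simp: word_of_types_def spots_def M_def)
  ultimately show thesis by (rule that)
qed

text \<open>An arrangement determines its preferences: they are read off by counting.\<close>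

lemma arrangement_realizes_some_tuple:
  obtains \<alpha> where "has_order k m \<alpha>" "realizes k m \<alpha> park"
proof -
  define before where
    "before i j = card {c \<in> cars k m. fst c \<in> {1..i - 1} \<and> park c < park (i, j)}" for i j
  define \<alpha> where "\<alpha> = (m 1, map (\<lambda>i. map (before i) [1..<Suc (m i)]) [2..<Suc k])"
  have pref: "pref \<alpha> i = map (before i) [1..<Suc (m i)]" if "i \<in> {2..k}" for i
  proof -
    from that have "[2..<Suc k] ! (i - 2) = i"
      by (subst nth_upt) auto
    moreover have "i - 2 < length [2..<Suc k]"
      using that by (simp del: upt_Suc) arith
    ultimately show ?thesis
      by (simp add: pref_def \<alpha>_def nth_map del: upt_Suc length_upt)
  qed
  have "has_order k m \<alpha>"
    by (simp add: has_order_def pref del: upt_Suc) (simp add: \<alpha>_def del: upt_Suc)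
  moreover have "realizes k m \<alpha> park"
    unfolding realizes_def before_def[symmetric] by (auto simp: pref simp del: upt_Suc)
  ultimately show thesis by (rule that)
qed

lemma parking_configuration_is_result:
  assumes "parking_configuration k m C"
  shows "\<exists>\<alpha>. exact_TPF k m \<alpha> \<and> results_in k m \<alpha> C"
  by (metis assms parking_configuration_has_arrangement arrangement_realizes_some_tuple
      exact_TPF_def results_in_def)

text \<open>Each factor is \<open>S\<^sub>i! / (S\<^sub>i\<^sub>-\<^sub>1! m\<^sub>i!)\<close> for the partial sums \<open>S\<^sub>i\<close>, so the product
  telescopes to the multinomial coefficient.\<close>

lemma prod_binomial_times_prod_fact:
  fixes m :: "nat \<Rightarrow> nat"
  shows "(\<Prod>i=1..k. (\<Sum>j=1..i. m j) choose m i) * (\<Prod>i=1..k. fact (m i)) = fact (\<Sum>i=1..k. m i)"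
proof (induction k)
  case (Suc k)
  let ?S = "\<Sum>i=1..k. m i" and ?a = "m (Suc k)"
  have "fact ?a * fact ?S * ((?S + ?a) choose ?a) = (fact (?S + ?a) :: nat)"
    using binomial_fact_lemma[of ?a "?S + ?a"] by simp
  with Suc.IH show ?case
    by (simp add: mult_ac)
qed simp

definition car_types :: "nat \<Rightarrow> (nat \<Rightarrow> nat) \<Rightarrow> nat multiset" where
  "car_types k m = (\<Sum>i=1..k. replicate_mset (m i) i)"

lemma count_car_types: "count (car_types k m) i = (if i \<in> {1..k} then m i else 0)"
  by (simp add: car_types_def count_sum)

lemma parking_configuration_iff_permutation:
  "parking_configuration k m C \<longleftrightarrow> C \<in> permutations_of_multiset (car_types k m)"
proof
  assume C: "parking_configuration k m C"
  have "count (mset C) i = count (car_types k m) i" for i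
    using C by (cases "i \<in> {1..k}")
      (auto simp: parking_configuration_def count_car_types count_mset count_list_0_iff)
  then show "C \<in> permutations_of_multiset (car_types k m)"
    by (simp add: permutations_of_multiset_def multiset_eq_iff)
next
  assume "C \<in> permutations_of_multiset (car_types k m)"
  then have C: "mset C = car_types k m"
    by (simp add: permutations_of_multiset_def)
  have count: "count_list C i = (if i \<in> {1..k} then m i else 0)" for i
    using C by (metis count_car_types count_mset)
  have "length C = size (car_types k m)"
    using C by (metis size_mset)
  also have "\<dots> = num_cars k m"
    by (simp add: car_types_def num_cars_def size_multiset_sum)
  finally show "parking_configuration k m C"
    using count by (auto simp: parking_configuration_def) (metis count_list_0_iff)+
qed

theorem theorem4p7:
  fixes k :: nat and m :: "nat \<Rightarrow> nat"
  assumes "k \<ge> 1"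
    and "\<forall>i\<in>{1..k}. m i > 0"
  shows "card {C. parking_configuration k m C \<and>
                  (\<exists>\<alpha>. exact_TPF k m \<alpha> \<and> results_in k m \<alpha> C)}
         = (\<Prod>i=1..k. (\<Sum>j=1..i. m j) choose m i)"
proof -
  let ?P = "permutations_of_multiset (car_types k m)"
  have "{C. parking_configuration k m C \<and> (\<exists>\<alpha>. exact_TPF k m \<alpha> \<and> results_in k m \<alpha> C)} = ?P"
    using parking_configuration_is_result parking_configuration_iff_permutation by blast
  moreover have "card ?P * (\<Prod>i=1..k. fact (m i)) = fact (\<Sum>i=1..k. m i)"
  proof -
    have "set_mset (car_types k m) = {1..k}"
      using assms(2) by (auto simp: count_car_types simp flip: count_greater_zero_iff split: if_splits)
    moreover have "size (car_types k m) = (\<Sum>i=1..k. m i)"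
      by (simp add: car_types_def size_multiset_sum)
    ultimately show ?thesis
      using card_permutations_of_multiset_aux[of "car_types k m"] by (simp add: count_car_types)
  qed
  moreover have "(\<Prod>i=1..k. fact (m i)) \<noteq> (0 :: nat)"
    by simp
  ultimately show ?thesis
    using prod_binomial_times_prod_fact[of m k] by (metis mult_right_cancel)
qed

end
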